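(* Let $Q=\{q_1,\dots,q_{|Q|}\}\subset\mathbb{S}^2$ be a finite nonempty set with $|Q|\le n$, and let $$P=\frac1M\sum_{i=1}^M\delta_{x_i},\qquad P'=\frac1M\sum_{i=1}^M\delta_{x_i'}$$ be empirical measures on $\mathbb{S}^2$ such that $d_G(x_i,x_i')\le\varepsilon$ for all $i$. Then $$\bigl|V_{n,2}(P;Q)-V_{n,2}(P';Q)\bigr|\le 2\pi\,\varepsilon.$$
   Context: $\mathbb{S}^2$ is the unit sphere in $\mathbb{R}^3$ with geodesic distance $d_G(x,y)=\arccos\langle x,y\rangle$. For $P=\frac1M\sum_{i=1}^M\delta_{x_i}$ with $x_i\in\mathbb{S}^2$ and a finite nonempty set $Q\subset\mathbb{S}^2$ with $|Q|\le n$, the distortion is $V_{n,2}(P;Q)=\frac1M\sum_{i=1}^M\min_{q\in Q}d_G(x_i,q)^2$. *)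

theory Defs
  imports "HOL-Probability.Probability"
begin

definition S2 :: "(real ^ 3) set" where
  "S2 = sphere 0 1"

definition dG :: "real ^ 3 \<Rightarrow> real ^ 3 \<Rightarrow> real" where
  "dG x y = arccos (x \<bullet> y)"

abbreviation borel_S2 :: "(real ^ 3) measure" where
  "borel_S2 \<equiv> restrict_space borel S2"

text \<open>The library has no addition of measures, so the average of Dirac measures
  is written out on each Borel set.\<close>

definition empirical_measure :: "nat \<Rightarrow> (nat \<Rightarrow> real ^ 3) \<Rightarrow> (real ^ 3) measure" where
  "empirical_measure M x =
     measure_of S2 (sets borel_S2)
       (\<lambda>A. (\<Sum>i=1..M. emeasure (return borel_S2 (x i)) A) / of_nat M)"

text \<open>The distortion \<open>V\<^sub>n\<^sub>,\<^sub>2(P; Q)\<close>. Its value does not depend on \<open>n\<close>, which only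
  bounds the cardinality of \<open>Q\<close>. For an empirical measure the integral is the average
  in \<open>distortion_empirical_measure\<close> below.\<close>

definition distortion :: "(real ^ 3) measure \<Rightarrow> (real ^ 3) set \<Rightarrow> real" where
  "distortion P Q = (\<integral>x. (MIN q\<in>Q. (dG x q)\<^sup>2) \<partial>P)"

lemma empirical_measure_eq_distr:
  assumes "M \<ge> 1" and x: "\<And>i. i \<in> {1..M} \<Longrightarrow> x i \<in> S2"
  shows "empirical_measure M x = distr (uniform_count_measure {1..M}) borel_S2 x"
proof -
  let ?D = "distr (uniform_count_measure {1..M}) borel_S2 x"
  have sp: "space borel_S2 = S2"
    by (simp add: space_restrict_space)
  have meas: "x \<in> measurable (uniform_count_measure {1..M}) borel_S2"
    using x sp by (auto simp: measurable_def space_uniform_count_measure sets_uniform_count_measure)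
  have eq: "(\<Sum>i=1..M. emeasure (return borel_S2 (x i)) A) / of_nat M = emeasure ?D A"
    if A: "A \<in> sets borel_S2" for A
  proof -
    have "(\<Sum>i=1..M. emeasure (return borel_S2 (x i)) A) = (\<Sum>i=1..M. indicator (x -` A) i)"
      using A by (intro sum.cong) (auto simp: indicator_def)
    also have "\<dots> = of_nat (card (x -` A \<inter> {1..M}))"
      by (simp add: indicator_def sum.If_cases vimage_def Int_commute)
    finally have l: "(\<Sum>i=1..M. emeasure (return borel_S2 (x i)) A) = of_nat (card (x -` A \<inter> {1..M}))" .
    have "emeasure ?D A = emeasure (uniform_count_measure {1..M}) (x -` A \<inter> {1..M})"
      using emeasure_distr[OF meas A] by (simp add: space_uniform_count_measure)
    also have "\<dots> = ennreal (card (x -` A \<inter> {1..M}) / card {1..M})"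
      by (rule emeasure_uniform_count_measure) auto
    also have "\<dots> = of_nat (card (x -` A \<inter> {1..M})) / of_nat M"
      using assms(1) by (simp add: divide_ennreal[symmetric] ennreal_of_nat_eq_real_of_nat)
    finally show ?thesis using l by simp
  qed
  have "empirical_measure M x = measure_of S2 (sets borel_S2) (emeasure ?D)"
    unfolding empirical_measure_def
  proof (rule measure_of_eq)
    show "sets borel_S2 \<subseteq> Pow S2"
      using sets.space_closed[of borel_S2] sp by simp
    fix A assume "A \<in> sigma_sets S2 (sets borel_S2)"
    then have "A \<in> sets borel_S2"
      using sets.sigma_sets_eq[of borel_S2] sp by simp
    then show "(\<Sum>i=1..M. emeasure (return borel_S2 (x i)) A) / of_nat M = emeasure ?D A"
      by (rule eq)
  qed
  also have "\<dots> = ?D"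
    using measure_of_of_measure[of ?D] sp by simp
  finally show ?thesis .
qed

lemma borel_measurable_Min_dG:
  assumes "finite Q" "Q \<noteq> {}" "Q \<subseteq> S2"
  shows "(\<lambda>x. MIN q\<in>Q. (dG x q)\<^sup>2) \<in> borel_measurable borel_S2"
proof -
  have 1: "(\<lambda>x. (dG x q)\<^sup>2) \<in> borel_measurable borel_S2" if "q \<in> Q" for q
  proof (rule borel_measurable_continuous_on_restrict)
    have "\<bar>x \<bullet> q\<bar> \<le> 1" if "x \<in> S2" for x
      using Cauchy_Schwarz_ineq2[of x q] that \<open>q \<in> Q\<close> assms(3) by (auto simp: S2_def)
    then have "-1 \<le> x \<bullet> q \<and> x \<bullet> q \<le> 1" if "x \<in> S2" for x
      using that by (auto simp: abs_le_iff minus_le_iff)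
    then show "continuous_on S2 (\<lambda>x. (dG x q)\<^sup>2)"
      unfolding dG_def by (intro continuous_intros) auto
  qed
  have "(\<lambda>x. MIN q\<in>R. (dG x q)\<^sup>2) \<in> borel_measurable borel_S2" if "finite R" "R \<noteq> {}" "R \<subseteq> Q" for R
    using that
  proof (induction R rule: finite_ne_induct)
    case (singleton q)
    then show ?case using 1 by simp
  next
    case (insert q F)
    then have "(\<lambda>x. min ((dG x q)\<^sup>2) (MIN q\<in>F. (dG x q)\<^sup>2)) \<in> borel_measurable borel_S2"
      using 1 by (intro borel_measurable_min) auto
    then show ?case using insert by simp
  qed
  then show ?thesis using assms by blast
qed

lemma distortion_empirical_measure:
  assumes "M \<ge> 1" and "\<And>i. i \<in> {1..M} \<Longrightarrow> x i \<in> S2"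
    and "finite Q" "Q \<noteq> {}" "Q \<subseteq> S2"
  shows "distortion (empirical_measure M x) Q =
           1 / real M * (\<Sum>i=1..M. MIN q\<in>Q. (dG (x i) q)\<^sup>2)"
proof -
  have meas: "x \<in> measurable (uniform_count_measure {1..M}) borel_S2"
    using assms(2) by (auto simp: measurable_def space_uniform_count_measure
        sets_uniform_count_measure space_restrict_space)
  have "empirical_measure M x = distr (uniform_count_measure {1..M}) borel_S2 x"
    using assms(1,2) by (rule empirical_measure_eq_distr)
  then have "distortion (empirical_measure M x) Q =
      (\<integral>i. (MIN q\<in>Q. (dG (x i) q)\<^sup>2) \<partial>uniform_count_measure {1..M})"
    unfolding distortion_def
    using integral_distr[OF meas borel_measurable_Min_dG[OF assms(3-5)]] by simp
  then show ?thesis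
    by (simp add: uniform_count_measure_def lebesgue_integral_point_measure_finite sum_divide_distrib)
qed

end

theory Submission
  imports Defs
begin

text \<open>The geodesic distance obeys the triangle inequality and takes values in \<open>[0, \<pi>]\<close>, so
  \<open>\<bar>d(x, q)\<^sup>2 - d(x', q)\<^sup>2\<bar> = \<bar>d(x, q) - d(x', q)\<bar> (d(x, q) + d(x', q)) \<le> 2 \<pi> \<epsilon>\<close> for every \<open>q\<close>.
  This bound survives taking minima over \<open>Q\<close> and averaging.\<close>

lemma abs_inner_le_1:
  fixes x y :: "'a :: real_inner"
  assumes "norm x = 1" "norm y = 1"
  shows "\<bar>x \<bullet> y\<bar> \<le> 1"
  using Cauchy_Schwarz_ineq2[of x y] assms by simp

text \<open>With a and b the angles at \<open>y\<close>, splitting \<open>x\<close> and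
  \<open>z\<close> along \<open>y\<close> gives the lower bound cos (a + b) for the inner product of
  \<open>x\<close> and \<open>z\<close>. Since cosine decreases on [0, \<pi>], this compares the
  angles themselves. The argument works in any real inner product space.\<close>

lemma arccos_inner_triangle:
  fixes x y z :: "'a :: real_inner"
  assumes "norm x = 1" "norm y = 1" "norm z = 1"
  shows "arccos (x \<bullet> z) \<le> arccos (x \<bullet> y) + arccos (y \<bullet> z)"
proof -
  note le1 = abs_inner_le_1[OF assms(1,2)] abs_inner_le_1[OF assms(2,3)] abs_inner_le_1[OF assms(1,3)]
  have nn: "0 \<le> arccos (x \<bullet> y)" "0 \<le> arccos (y \<bullet> z)" "arccos (x \<bullet> z) \<le> pi"
    using le1 by (auto intro: arccos_lbound arccos_ubound)
  have sq: "x \<bullet> x = 1" "y \<bullet> y = 1" "z \<bullet> z = 1"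
    using assms by (simp_all add: norm_eq_1)
  \<comment> \<open>Cauchy--Schwarz for the components of \<open>x\<close> and \<open>z\<close> orthogonal to \<open>y\<close>, whose norms are
    the sines of the two angles at \<open>y\<close>\<close>
  define u v where "u = x - (x \<bullet> y) *\<^sub>R y" and "v = z - (y \<bullet> z) *\<^sub>R y"
  have uv: "u \<bullet> v = x \<bullet> z - (x \<bullet> y) * (y \<bullet> z)"
    by (simp add: u_def v_def inner_diff_left inner_diff_right sq)
  have "norm u = sqrt (1 - (x \<bullet> y)\<^sup>2)" "norm v = sqrt (1 - (y \<bullet> z)\<^sup>2)"
    by (simp_all add: norm_eq_sqrt_inner u_def v_def inner_diff_left inner_diff_right sq
        inner_commute[of y x] inner_commute[of z y] power2_eq_square)
  then have "norm u = sin (arccos (x \<bullet> y))" "norm v = sin (arccos (y \<bullet> z))"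
    using le1 by (simp_all add: sin_arccos_abs)
  \<comment> \<open>Only the lower half of Cauchy--Schwarz matters: \<open>u \<bullet> v\<close> is
    at least minus the product of the two sines, and adding the product of the cosines gives the
    addition formula.\<close>
  then have "cos (arccos (x \<bullet> y) + arccos (y \<bullet> z)) \<le> x \<bullet> z"
    using Cauchy_Schwarz_ineq2[of u v] uv le1 by (simp add: cos_add abs_le_iff)
  then have *: "cos (arccos (x \<bullet> y) + arccos (y \<bullet> z)) \<le> cos (arccos (x \<bullet> z))"
    using le1 by simp
  show ?thesis
  \<comment> \<open>Cosine can be inverted monotonically only on [0, \<pi>]. A sum of angles beyond
    \<pi> already exceeds every value of \<open>arccos\<close> on [-1, 1].\<close>
  proof (cases "arccos (x \<bullet> y) + arccos (y \<bullet> z) \<le> pi")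
    case True
    then show ?thesis
      using * nn le1 by (subst (asm) cos_mono_le_eq) (auto intro: arccos_lbound)
  next
    case False
    then show ?thesis using nn by linarith
  qed
qed

lemma dG_commute: "dG x y = dG y x"
  by (simp add: dG_def inner_commute)

lemma dG_bounds:
  assumes "x \<in> S2" "y \<in> S2"
  shows "0 \<le> dG x y" "dG x y \<le> pi"
  using abs_inner_le_1[of x y] assms
  by (auto simp: dG_def S2_def intro!: arccos_lbound arccos_ubound)

lemma dG_triangle:
  assumes "x \<in> S2" "y \<in> S2" "z \<in> S2"
  shows "dG x z \<le> dG x y + dG y z"
  using arccos_inner_triangle[of x y z] assms by (simp add: dG_def S2_def)

lemma dG_power2_diff_le:
  assumes "x \<in> S2" "x' \<in> S2" "q \<in> S2"
  shows "\<bar>(dG x q)\<^sup>2 - (dG x' q)\<^sup>2\<bar> \<le> 2 * pi * dG x x'"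
proof -
  have "\<bar>dG x q - dG x' q\<bar> \<le> dG x x'"
    using dG_triangle[of x x' q] dG_triangle[of x' x q] assms dG_commute[of x x'] by auto
  moreover have "\<bar>dG x q + dG x' q\<bar> \<le> 2 * pi"
    using dG_bounds[of x q] dG_bounds[of x' q] assms by auto
  ultimately have "\<bar>dG x q + dG x' q\<bar> * \<bar>dG x q - dG x' q\<bar> \<le> 2 * pi * dG x x'"
    by (intro mult_mono) auto
  then show ?thesis
    by (simp add: abs_mult[symmetric] power2_eq_square algebra_simps)
qed

text \<open>\<open>f\<close> and \<open>g\<close> may attain their minima at different points, so
  each minimum is compared with the other function's value at its own minimizer.\<close>

lemma abs_Min_diff_le:
  fixes f g :: "'a \<Rightarrow> 'b :: linordered_idom"
  assumes "finite A" "A \<noteq> {}" and "\<And>a. a \<in> A \<Longrightarrow> \<bar>f a - g a\<bar> \<le> c"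
  shows "\<bar>(MIN a\<in>A. f a) - (MIN a\<in>A. g a)\<bar> \<le> c"
proof -
  \<comment> \<open>The one-sided bound is kept generic in \<open>h\<close> and \<open>k\<close> so
    that it applies with \<open>f\<close> and \<open>g\<close> in both orders.\<close>
  have le: "(MIN a\<in>A. h a) \<le> (MIN a\<in>A. k a) + c"
    if "\<And>a. a \<in> A \<Longrightarrow> h a \<le> k a + c" for h k :: "'a \<Rightarrow> 'b"
  proof -
    have "(MIN a\<in>A. k a) \<in> k ` A"
      using assms(1,2) by (intro Min_in) auto
    then obtain a where a: "a \<in> A" "(MIN a\<in>A. k a) = k a" by blast
    have "(MIN a\<in>A. h a) \<le> h a"
      using assms(1) a(1) by simp
    also have "\<dots> \<le> k a + c" using that a(1) .
    finally show ?thesis using a(2) by simp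
  qed
  have "f a \<le> g a + c" "g a \<le> f a + c" if "a \<in> A" for a
    using assms(3)[OF that] by (simp_all add: abs_le_iff algebra_simps)
  then show ?thesis
    using le[of f g] le[of g f] by (simp add: abs_le_iff algebra_simps)
qed

theorem lemma5p3:
  fixes Q :: "(real ^ 3) set" and n M :: nat
    and x x' :: "nat \<Rightarrow> real ^ 3" and P P' :: "(real ^ 3) measure" and \<epsilon> :: real
  assumes "finite Q" and "Q \<noteq> {}" and "Q \<subseteq> S2" and "card Q \<le> n"
    and "M \<ge> 1"
    and "\<And>i. i \<in> {1..M} \<Longrightarrow> x i \<in> S2"
    and "\<And>i. i \<in> {1..M} \<Longrightarrow> x' i \<in> S2"
    and "P = empirical_measure M x"
    and "P' = empirical_measure M x'"
    and "\<And>i. i \<in> {1..M} \<Longrightarrow> dG (x i) (x' i) \<le> \<epsilon>"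
  shows "\<bar>distortion P Q - distortion P' Q\<bar> \<le> 2 * pi * \<epsilon>"
proof -
  define m where "m y = (MIN q\<in>Q. (dG y q)\<^sup>2)" for y
  have m: "\<bar>m (x i) - m (x' i)\<bar> \<le> 2 * pi * \<epsilon>" if i: "i \<in> {1..M}" for i
    unfolding m_def
  proof (rule abs_Min_diff_le[OF assms(1,2)])
    fix q assume "q \<in> Q"
    then have "\<bar>(dG (x i) q)\<^sup>2 - (dG (x' i) q)\<^sup>2\<bar> \<le> 2 * pi * dG (x i) (x' i)"
      using assms(3) assms(6,7)[OF i] by (intro dG_power2_diff_le) auto
    also have "\<dots> \<le> 2 * pi * \<epsilon>"
      using assms(10)[OF i] by (intro mult_left_mono) auto
    finally show "\<bar>(dG (x i) q)\<^sup>2 - (dG (x' i) q)\<^sup>2\<bar> \<le> 2 * pi * \<epsilon>" .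
  qed
  \<comment> \<open>Both integrals become averages over the same index set, so the points can be
    compared pair by pair.\<close>
  have "distortion P Q = 1 / real M * (\<Sum>i=1..M. m (x i))"
    unfolding assms(8) m_def using assms by (intro distortion_empirical_measure) auto
  moreover have "distortion P' Q = 1 / real M * (\<Sum>i=1..M. m (x' i))"
    unfolding assms(9) m_def using assms by (intro distortion_empirical_measure) auto
  ultimately have "\<bar>distortion P Q - distortion P' Q\<bar>
      = \<bar>\<Sum>i=1..M. m (x i) - m (x' i)\<bar> / real M"
    by (simp add: sum_subtractf diff_divide_distrib[symmetric])
  also have "\<bar>\<Sum>i=1..M. m (x i) - m (x' i)\<bar> \<le> (\<Sum>i=1..M. \<bar>m (x i) - m (x' i)\<bar>)"
    by (rule sum_abs)
  also have "\<dots> \<le> real M * (2 * pi * \<epsilon>)"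
    using sum_bounded_above[of "{1..M}" "\<lambda>i. \<bar>m (x i) - m (x' i)\<bar>", OF m] by simp
  finally show ?thesis
    using assms(5) by (simp add: divide_right_mono field_simps)
qed

end
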